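(* Let $n\ge 1$ be an integer and $\lambda_s,\lambda_e>0$. For the disconnected network of $n$ nodes with rate-changing gossip ($DC_{\mathrm{RC}}$), the long-term average freshness of every node $i$ is $$\overline{F}_i^{DC_{\mathrm{RC}}}=\frac{\lambda_s}{n\lambda_e}\left[1-\left(\frac{\lambda_s}{\lambda_s+\lambda_e}\right)^n\right].$$
   Context: A source self-updates according to a Poisson process of rate $\lambda_e$, and $n$ nodes track it. A node is fresh at time $t$ ($F_i(t)=1$) if it holds the current version of the source's information, and stale ($F_i(t)=0$) otherwise. The long-term average freshness of node $i$ is $\overline{F}_i=\limsup_{T\to\infty}\frac1T\mathbb{E}\big[\int_0^T F_i(t)\,dt\big]$. In the disconnected network with rate-changing gossip ($DC_{\mathrm{RC}}$), nodes receive updates only from the source, and the source splits its total update rate $\lambda_s$ equally among the currently stale nodes. Equivalently, the set $S(t)\subseteq\{1,\dots,n\}$ of fresh nodes is a continuous-time Markov chain with the following transitions: - from any $S$, at rate $\lambda_e$ the source self-updates and the state becomes $\emptyset$ (all nodes stale); - from $S$ with $|S|<n$, for each $i\notin S$, at rate $\lambda_s/(n-|S|)$ node $i$ is updated and the state becomes $S\cup\{i\}$. All nodes are stale at time $0$, and $F_i(t)=\mathbb{I}_{\{i\in S(t)\}}$. *)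

theory Defs
  imports "HOL-Probability.Probability"
begin

section \<open>Continuous-time Markov chains on a finite state space\<close>

definition transition_function :: "'s set \<Rightarrow> (real \<Rightarrow> 's \<Rightarrow> 's \<Rightarrow> real) \<Rightarrow> bool" where
  "transition_function E P \<longleftrightarrow>
     (\<forall>t\<ge>0. \<forall>x\<in>E. \<forall>y\<in>E. 0 \<le> P t x y) \<and>
     (\<forall>t\<ge>0. \<forall>x\<in>E. (\<Sum>y\<in>E. P t x y) = 1) \<and>
     (\<forall>x\<in>E. \<forall>y\<in>E. P 0 x y = of_bool (x = y)) \<and>
     (\<forall>s\<ge>0. \<forall>t\<ge>0. \<forall>x\<in>E. \<forall>z\<in>E. P (s + t) x z = (\<Sum>y\<in>E. P s x y * P t y z))"

text \<open>Only off-diagonal rates matter. On a finite state space the rows of \<^term>\<open>P h\<close> sum to one,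
  so the off-diagonal limits already give
  \<open>P h x x = 1 - h * (\<Sum>y\<in>E - {x}. q x y) + o(h)\<close>, the usual diagonal of the generator.\<close>

definition has_jump_rates ::
  "'s set \<Rightarrow> (real \<Rightarrow> 's \<Rightarrow> 's \<Rightarrow> real) \<Rightarrow> ('s \<Rightarrow> 's \<Rightarrow> real) \<Rightarrow> bool" where
  "has_jump_rates E P q \<longleftrightarrow>
     (\<forall>x\<in>E. \<forall>y\<in>E. x \<noteq> y \<longrightarrow> ((\<lambda>h. P h x y / h) \<longlongrightarrow> q x y) (at_right 0))"

text \<open>Time is \<^typ>\<open>real\<close>, restricted to nonnegative values. The Markov property is stated for
  finite histories \<open>X s = z s\<close>, \<open>s \<in> J \<subseteq> {0..t}\<close>, of positive probability (these generate the
  history up to time \<open>t\<close>), since conditional probabilities given null events are 0 by convention.\<close>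

definition has_markov_property ::
  "'w measure \<Rightarrow> 's set \<Rightarrow> (real \<Rightarrow> 's \<Rightarrow> 's \<Rightarrow> real) \<Rightarrow> (real \<Rightarrow> 'w \<Rightarrow> 's) \<Rightarrow> bool" where
  "has_markov_property M E P X \<longleftrightarrow>
     (\<forall>t\<ge>0. \<forall>h\<ge>0. \<forall>J z. \<forall>x\<in>E. \<forall>y\<in>E. finite J \<longrightarrow> J \<subseteq> {0..t} \<longrightarrow>
        \<P>(\<omega> in M. X t \<omega> = x \<and> (\<forall>s\<in>J. X s \<omega> = z s)) > 0 \<longrightarrow>
        \<P>(\<omega> in M. X (t + h) \<omega> = y \<bar> X t \<omega> = x \<and> (\<forall>s\<in>J. X s \<omega> = z s)) = P h x y)"

text \<open>The right-continuity assumption is with respect to the discrete topology on the states.\<close>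

locale finite_ctmc = prob_space M
  for M :: "'w measure" and E :: "'s set" and q :: "'s \<Rightarrow> 's \<Rightarrow> real" and X :: "real \<Rightarrow> 'w \<Rightarrow> 's" +
  assumes finite_states: "finite E"
    and measurable_state: "t \<ge> 0 \<Longrightarrow> X t \<in> measurable M (count_space E)"
    and right_continuous_paths:
      "\<omega> \<in> space M \<Longrightarrow> t \<ge> 0 \<Longrightarrow> \<forall>\<^sub>F s in at_right t. X s \<omega> = X t \<omega>"
    and markov:
      "\<exists>P. transition_function E P \<and> has_jump_rates E P q \<and> has_markov_property M E P X"

section \<open>The disconnected network with rate-changing gossip\<close>

text \<open>The rate from the fresh set \<open>A\<close> to the fresh set \<open>B\<close> is the sum of the rates of all transitions
  leading from \<open>A\<close> to \<open>B\<close>. The diagonal entry at \<open>{}\<close> (a source update when all nodes are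
  stale already) is not a jump of the chain and is ignored by \<^const>\<open>has_jump_rates\<close>.\<close>

definition dc_rc_rate :: "nat \<Rightarrow> real \<Rightarrow> real \<Rightarrow> nat set \<Rightarrow> nat set \<Rightarrow> real" where
  "dc_rc_rate n lam_s lam_e A B =
     (if B = {} then lam_e else 0) +
     (\<Sum>i\<in>{1..n} - A. if B = insert i A then lam_s / real (n - card A) else 0)"

definition dc_rc_network ::
  "nat \<Rightarrow> real \<Rightarrow> real \<Rightarrow> 'w measure \<Rightarrow> (real \<Rightarrow> 'w \<Rightarrow> nat set) \<Rightarrow> bool" where
  "dc_rc_network n lam_s lam_e M S \<longleftrightarrow>
     finite_ctmc M (Pow {1..n}) (dc_rc_rate n lam_s lam_e) S \<and> (AE \<omega> in M. S 0 \<omega> = {})"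

definition freshness :: "(real \<Rightarrow> 'w \<Rightarrow> nat set) \<Rightarrow> nat \<Rightarrow> real \<Rightarrow> 'w \<Rightarrow> real" where
  "freshness S i t \<omega> = indicator (S t \<omega>) i"

definition long_term_average :: "'w measure \<Rightarrow> (real \<Rightarrow> 'w \<Rightarrow> real) \<Rightarrow> ereal" where
  "long_term_average M F =
     Limsup at_top (\<lambda>T::real. ereal (1 / T * (LINT \<omega>|M. (LINT t:{0..T}|lborel. F t \<omega>))))"

end

theory Submission
  imports Defs
begin

text \<open>Dynkin's formula is applied to a solution \<open>\<phi>\<close> of the Poisson equation
  \<open>L \<phi> = \<lambda>\<^sub>e (\<phi> {} - \<one>[i \<in> A])\<close> of the chain, where \<open>L\<close> is the generator. Over \<open>[0, T]\<close> the
  left-hand side integrates to the bounded quantity \<open>E \<phi> (S T) - E \<phi> (S 0)\<close>, so after division by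
  \<open>T\<close> the average freshness converges to the constant \<open>\<phi> {}\<close>, whatever the initial state.\<close>

section \<open>Expectations of functions of the state at one time\<close>

context finite_ctmc
begin

text \<open>The differences make the summand \<open>y = x\<close> vanish, so \<open>q x x\<close>
  may be arbitrary; for the network it equals \<open>lam_e\<close> at the empty set.\<close>

definition generator :: "('s \<Rightarrow> real) \<Rightarrow> 's \<Rightarrow> real" where
  "generator f x = (\<Sum>y\<in>E. q x y * (f y - f x))"

lemma state_in_states: "t \<ge> 0 \<Longrightarrow> \<omega> \<in> space M \<Longrightarrow> X t \<omega> \<in> E"
  using measurable_space[OF measurable_state, of t \<omega>] by simp

lemma measurable_function_of_state [measurable]:
  fixes f :: "'s \<Rightarrow> real"
  assumes "t \<ge> 0"
  shows "(\<lambda>\<omega>. f (X t \<omega>)) \<in> borel_measurable M"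
  by (rule measurable_compose[OF measurable_state[OF assms]]) simp

lemma state_event:
  assumes "t \<ge> 0"
  shows "{\<omega> \<in> space M. X t \<omega> = x} \<in> events"
proof -
  \<comment> \<open>Since \<open>x\<close> may lie outside \<open>E\<close>, \<open>{x}\<close> need
    not be measurable in \<open>count_space E\<close>; a real-valued indicator avoids the case
    distinction.\<close>
  have "(\<lambda>\<omega>. indicator {x} (X t \<omega>) :: real) -` {1} \<inter> space M \<in> events"
    by (rule measurable_sets[OF measurable_function_of_state[OF assms]]) simp
  moreover have "(\<lambda>\<omega>. indicator {x} (X t \<omega>) :: real) -` {1} \<inter> space M = {\<omega> \<in> space M. X t \<omega> = x}"
    by (auto simp: indicator_def)
  ultimately show ?thesis
    by simp
qed

lemma expectation_function_of_state:
  fixes f :: "'s \<Rightarrow> real"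
  assumes "t \<ge> 0"
  shows "expectation (\<lambda>\<omega>. f (X t \<omega>)) = (\<Sum>x\<in>E. \<P>(\<omega> in M. X t \<omega> = x) * f x)"
proof -
  have "expectation (\<lambda>\<omega>. f (X t \<omega>)) =
      expectation (\<lambda>\<omega>. \<Sum>x\<in>E. indicator {\<omega> \<in> space M. X t \<omega> = x} \<omega> * f x)"
  proof (rule Bochner_Integration.integral_cong[OF refl])
    fix \<omega> assume "\<omega> \<in> space M"
    then have "(\<Sum>x\<in>E. indicator {\<omega> \<in> space M. X t \<omega> = x} \<omega> * f x) = (\<Sum>x\<in>E. if X t \<omega> = x then f x else 0)"
      by (intro sum.cong) (auto simp: indicator_def)
    then show "f (X t \<omega>) = (\<Sum>x\<in>E. indicator {\<omega> \<in> space M. X t \<omega> = x} \<omega> * f x)"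
      using state_in_states[OF assms \<open>\<omega> \<in> space M\<close>] finite_states by simp
  qed
  also have "\<dots> = (\<Sum>x\<in>E. \<P>(\<omega> in M. X t \<omega> = x) * f x)"
    using state_event[OF assms]
    by (subst Bochner_Integration.integral_sum)
       (auto intro!: integrable_mult_left integrable_real_indicator simp: emeasure_eq_measure Int_absorb2)
  finally show ?thesis .
qed

text \<open>Crude, but uniform in \<open>t\<close>: this controls the one-step error at all times at
  once, and later the boundary terms as \<open>T\<close> grows.\<close>

lemma abs_expectation_function_of_state_le:
  fixes f :: "'s \<Rightarrow> real"
  assumes "t \<ge> 0"
  shows "\<bar>expectation (\<lambda>\<omega>. f (X t \<omega>))\<bar> \<le> (\<Sum>x\<in>E. \<bar>f x\<bar>)"
  unfolding expectation_function_of_state[OF assms]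
  by (rule order_trans[OF sum_abs sum_mono]) (simp add: abs_mult mult_left_le_one_le)

section \<open>Kolmogorov's forward equation and Dynkin's formula\<close>

text \<open>The jump rates give a first-order expansion of \<open>P h\<close> with error
  \<open>R h x\<close> in each of finitely many states; averaging over the law of \<open>X t\<close>
  keeps the error below the sum over all states. That \<open>\<rho>\<close> does not depend on
  \<open>t\<close> is what makes left derivatives accessible as well.\<close>

lemma expectation_increment_bound:
  fixes f :: "'s \<Rightarrow> real"
  shows "\<exists>\<rho>. (\<rho> \<longlongrightarrow> 0) (at_right 0) \<and> (\<forall>t\<ge>0. \<forall>h>0.
     \<bar>expectation (\<lambda>\<omega>. f (X (t + h) \<omega>)) - expectation (\<lambda>\<omega>. f (X t \<omega>))
        - h * expectation (\<lambda>\<omega>. generator f (X t \<omega>))\<bar> \<le> h * \<rho> h)"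
proof -
  obtain P where tf: "transition_function E P" and jr: "has_jump_rates E P q"
    and mp: "has_markov_property M E P X"
    using markov by blast
  define R where "R h x = ((\<Sum>y\<in>E. P h x y * f y) - f x) / h - generator f x" for h x
  have R_tendsto: "((\<lambda>h. R h x) \<longlongrightarrow> 0) (at_right 0)" if x: "x \<in> E" for x
  proof -
    have "((\<lambda>h. \<Sum>y\<in>E. P h x y / h * (f y - f x)) \<longlongrightarrow> (\<Sum>y\<in>E. q x y * (f y - f x))) (at_right 0)"
    proof (rule tendsto_sum)
      fix y assume y: "y \<in> E"
      show "((\<lambda>h. P h x y / h * (f y - f x)) \<longlongrightarrow> q x y * (f y - f x)) (at_right 0)"
      proof (cases "x = y")
        case False
        then show ?thesis
          using jr x y unfolding has_jump_rates_def by (intro tendsto_mult_right) blast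
      qed simp
    qed
    moreover have "\<forall>\<^sub>F h in at_right 0. (\<Sum>y\<in>E. P h x y / h * (f y - f x)) =
        ((\<Sum>y\<in>E. P h x y * f y) - f x) / h"
      using eventually_at_right_less[of 0]
    proof eventually_elim
      case (elim h)
      then have "(\<Sum>y\<in>E. P h x y) = 1"
        using tf x unfolding transition_function_def by (meson less_imp_le)
      then have "f x = (\<Sum>y\<in>E. P h x y * f x)"
        by (simp flip: sum_distrib_right)
      then have "(\<Sum>y\<in>E. P h x y * f y) - f x = (\<Sum>y\<in>E. P h x y * (f y - f x))"
        by (simp add: right_diff_distrib sum_subtractf)
      then show ?case
        by (simp add: sum_divide_distrib)
    qed
    ultimately have "((\<lambda>h. ((\<Sum>y\<in>E. P h x y * f y) - f x) / h) \<longlongrightarrow> generator f x) (at_right 0)"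
      unfolding generator_def by (rule Lim_transform_eventually)
    then show ?thesis
      unfolding R_def by (rule LIM_zero)
  qed
  have "((\<lambda>h. \<Sum>x\<in>E. \<bar>R h x\<bar>) \<longlongrightarrow> (\<Sum>x\<in>E. \<bar>0\<bar>)) (at_right 0)"
    by (intro tendsto_sum tendsto_rabs R_tendsto)
  moreover have "\<bar>expectation (\<lambda>\<omega>. f (X (t + h) \<omega>)) - expectation (\<lambda>\<omega>. f (X t \<omega>))
        - h * expectation (\<lambda>\<omega>. generator f (X t \<omega>))\<bar> \<le> h * (\<Sum>x\<in>E. \<bar>R h x\<bar>)"
    if t: "t \<ge> 0" and h: "h > 0" for t h
  proof -
    have th: "t + h \<ge> 0" using t h by simp
    let ?p = "\<lambda>x. \<P>(\<omega> in M. X t \<omega> = x)"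
    have joint: "\<P>(\<omega> in M. X (t + h) \<omega> = y \<and> X t \<omega> = x) = ?p x * P h x y"
      if "x \<in> E" "y \<in> E" for x y
    \<comment> \<open>The Markov property, taken with empty history, fixes the conditional
      probability only when the condition has positive probability; otherwise both sides are
      zero.\<close>
    proof (cases "?p x > 0")
      case True
      then have "\<P>(\<omega> in M. X (t + h) \<omega> = y \<bar> X t \<omega> = x) = P h x y"
        using mp[unfolded has_markov_property_def, rule_format, of t h x y "{}"] t h that by simp
      with True show ?thesis
        by (simp add: cond_prob_def field_simps)
    next
      case False
      then have "?p x = 0"
        by (simp add: order_antisym_conv not_less)
      moreover have "\<P>(\<omega> in M. X (t + h) \<omega> = y \<and> X t \<omega> = x) \<le> ?p x"
        using state_event[OF t] by (intro finite_measure_mono) auto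
      ultimately show ?thesis
        by (simp add: measure_le_0_iff)
    qed
    have law: "\<P>(\<omega> in M. X (t + h) \<omega> = y) = (\<Sum>x\<in>E. ?p x * P h x y)" if "y \<in> E" for y
    proof -
      have "{\<omega> \<in> space M. X (t + h) \<omega> = y} = (\<Union>x\<in>E. {\<omega> \<in> space M. X (t + h) \<omega> = y \<and> X t \<omega> = x})"
        using state_in_states[OF t] by auto
      moreover have "{\<omega> \<in> space M. X (t + h) \<omega> = y \<and> X t \<omega> = x} \<in> events" for x
      proof -
        have "{\<omega> \<in> space M. X (t + h) \<omega> = y \<and> X t \<omega> = x} =
            {\<omega> \<in> space M. X (t + h) \<omega> = y} \<inter> {\<omega> \<in> space M. X t \<omega> = x}"
          by auto
        then show ?thesis
          using state_event[OF th] state_event[OF t] by simp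
      qed
      ultimately have "\<P>(\<omega> in M. X (t + h) \<omega> = y) = (\<Sum>x\<in>E. \<P>(\<omega> in M. X (t + h) \<omega> = y \<and> X t \<omega> = x))"
        using finite_states
        by (auto intro!: finite_measure_finite_Union simp: disjoint_family_on_def)
      then show ?thesis
        using joint that by simp
    qed
    have "expectation (\<lambda>\<omega>. f (X (t + h) \<omega>)) = (\<Sum>y\<in>E. \<Sum>x\<in>E. ?p x * P h x y * f y)"
      unfolding expectation_function_of_state[OF th]
      by (intro sum.cong) (simp_all add: law sum_distrib_right)
    also have "\<dots> = (\<Sum>x\<in>E. ?p x * (\<Sum>y\<in>E. P h x y * f y))"
      by (subst sum.swap) (simp add: sum_distrib_left mult.assoc)
    also have "\<dots> = (\<Sum>x\<in>E. ?p x * f x + h * (?p x * generator f x) + h * (?p x * R h x))"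
      using h by (intro sum.cong) (simp_all add: R_def field_simps)
    also have "\<dots> = expectation (\<lambda>\<omega>. f (X t \<omega>)) + h * expectation (\<lambda>\<omega>. generator f (X t \<omega>))
        + h * expectation (\<lambda>\<omega>. R h (X t \<omega>))"
      by (simp add: expectation_function_of_state[OF t] sum.distrib sum_distrib_left)
    finally have "\<bar>expectation (\<lambda>\<omega>. f (X (t + h) \<omega>)) - expectation (\<lambda>\<omega>. f (X t \<omega>))
        - h * expectation (\<lambda>\<omega>. generator f (X t \<omega>))\<bar> = h * \<bar>expectation (\<lambda>\<omega>. R h (X t \<omega>))\<bar>"
      using h by (simp add: abs_mult)
    then show ?thesis
      using abs_expectation_function_of_state_le[OF t, of "R h"] h by simp
  qed
  ultimately show ?thesis
    by (intro exI[of _ "\<lambda>h. \<Sum>x\<in>E. \<bar>R h x\<bar>"]) simp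
qed

text \<open>The increment bound looks forward in time, so for \<open>s < t\<close> it expands at
  \<open>s\<close> and produces the generator term at \<open>s\<close> instead of \<open>t\<close>.
  Applying the same bound to \<open>generator f\<close> shows that this term moves by at most a
  vanishing amount.\<close>

lemma expectation_has_derivative_generator:
  fixes f :: "'s \<Rightarrow> real"
  assumes t: "t \<ge> 0"
  shows "((\<lambda>t. expectation (\<lambda>\<omega>. f (X t \<omega>))) has_real_derivative
      expectation (\<lambda>\<omega>. generator f (X t \<omega>))) (at t within {0..})"
proof -
  define u where "u g t = expectation (\<lambda>\<omega>. g (X t \<omega>))" for g :: "'s \<Rightarrow> real" and t
  let ?g = "generator f"
  obtain \<rho> where \<rho>: "(\<rho> \<longlongrightarrow> 0) (at_right 0)"
    and \<rho>_bound: "\<And>t h. t \<ge> 0 \<Longrightarrow> h > 0 \<Longrightarrow> \<bar>u f (t + h) - u f t - h * u ?g t\<bar> \<le> h * \<rho> h"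
    using expectation_increment_bound[of f] unfolding u_def by blast
  obtain \<tau> where \<tau>: "(\<tau> \<longlongrightarrow> 0) (at_right 0)"
    and \<tau>_bound: "\<And>t h. t \<ge> 0 \<Longrightarrow> h > 0 \<Longrightarrow>
        \<bar>u ?g (t + h) - u ?g t - h * u (generator ?g) t\<bar> \<le> h * \<tau> h"
    using expectation_increment_bound[of ?g] unfolding u_def by blast
  define C where "C = (\<Sum>x\<in>E. \<bar>generator ?g x\<bar>)"
  have bound: "\<bar>(u f s - u f t) / (s - t) - u ?g t\<bar> \<le> \<rho> \<bar>s - t\<bar> + \<bar>s - t\<bar> * (\<tau> \<bar>s - t\<bar> + C)"
    if s: "s \<ge> 0" "s \<noteq> t" for s
  proof -
    define a h where "a = min s t" and "h = \<bar>s - t\<bar>"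
    have ah: "a \<ge> 0" "h > 0"
      using s t by (auto simp: a_def h_def)
    have "\<bar>u (generator ?g) a\<bar> \<le> C"
      unfolding u_def C_def by (rule abs_expectation_function_of_state_le[OF ah(1)])
    then have "\<bar>h * u (generator ?g) a\<bar> \<le> h * C"
      using ah by (simp add: abs_mult)
    then have 1: "\<bar>u ?g (a + h) - u ?g a\<bar> \<le> h * (\<tau> h + C)"
      using \<tau>_bound[OF ah] by (simp add: distrib_left)
    \<comment> \<open>For \<open>s < t\<close> the point \<open>t\<close> is \<open>a + h\<close>;
      otherwise \<open>a = t\<close>, and \<open>1\<close> supplies the nonnegativity of the
      right-hand side.\<close>
    then have 2: "\<bar>u ?g a - u ?g t\<bar> \<le> h * (\<tau> h + C)"
      by (cases "s < t") (auto simp: a_def h_def)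
    have "(u f s - u f t) / (s - t) = (u f (a + h) - u f a) / h"
      using s by (cases "s < t") (auto simp: a_def h_def field_simps)
    moreover have "\<bar>(u f (a + h) - u f a) / h - u ?g a\<bar> \<le> \<rho> h"
    proof -
      have "(u f (a + h) - u f a) / h - u ?g a = (u f (a + h) - u f a - h * u ?g a) / h"
        using ah by (simp add: field_simps)
      then show ?thesis
        using \<rho>_bound[OF ah] ah by (simp add: abs_divide field_simps)
    qed
    ultimately show ?thesis
      using 2 unfolding h_def by linarith
  qed
  have dist0: "filterlim (\<lambda>s. \<bar>s - t\<bar>) (at_right 0) (at t within {0..})"
    unfolding filterlim_at
    by (auto simp: eventually_at_filter intro!: tendsto_eq_intros)
  have "((\<lambda>s. \<rho> \<bar>s - t\<bar> + \<bar>s - t\<bar> * (\<tau> \<bar>s - t\<bar> + C)) \<longlongrightarrow> 0) (at t within {0..})"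
    using filterlim_compose[OF \<rho> dist0] filterlim_compose[OF \<tau> dist0] dist0
    by (auto simp: filterlim_at intro!: tendsto_eq_intros)
  then have "((\<lambda>s. (u f s - u f t) / (s - t) - u ?g t) \<longlongrightarrow> 0) (at t within {0..})"
    by (rule Lim_null_comparison[rotated]) (simp_all add: eventually_at_filter bound del: abs_divide)
  then show ?thesis
    unfolding has_field_derivative_iff u_def by (rule LIM_zero_cancel)
qed

lemma continuous_on_expectation_function_of_state:
  fixes f :: "'s \<Rightarrow> real"
  shows "continuous_on {0..} (\<lambda>t. expectation (\<lambda>\<omega>. f (X t \<omega>)))"
  by (auto simp: continuous_on_eq_continuous_within
      intro: DERIV_continuous expectation_has_derivative_generator)

text \<open>This is the fundamental theorem of calculus: the derivative is again an expectation of a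
  function of the state, hence continuous.\<close>

lemma dynkin_formula:
  fixes f :: "'s \<Rightarrow> real"
  assumes "T \<ge> 0"
  shows "(LINT t:{0..T}|lborel. expectation (\<lambda>\<omega>. generator f (X t \<omega>))) =
      expectation (\<lambda>\<omega>. f (X T \<omega>)) - expectation (\<lambda>\<omega>. f (X 0 \<omega>))"
  unfolding set_lebesgue_integral_def
proof (rule integral_FTC_Icc[OF assms])
  show "((\<lambda>t. expectation (\<lambda>\<omega>. f (X t \<omega>))) has_vector_derivative
      expectation (\<lambda>\<omega>. generator f (X t \<omega>))) (at t within {0..T})" if "0 \<le> t" "t \<le> T" for t
    using DERIV_subset[OF expectation_has_derivative_generator[OF that(1)], of "{0..T}"]
    by (auto simp: has_real_derivative_iff_has_vector_derivative)
  show "continuous_on {0..T} (\<lambda>t. expectation (\<lambda>\<omega>. generator f (X t \<omega>)))"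
    by (rule continuous_on_subset[OF continuous_on_expectation_function_of_state]) auto
qed

section \<open>Exchanging expectation and time integral\<close>

text \<open>Right-continuity makes the process a pointwise limit of its values on the grids
  \<open>\<nat> / (k + 1)\<close>, approached strictly from the right.\<close>

lemma jointly_measurable_function_of_state:
  fixes f :: "'s \<Rightarrow> real"
  shows "(\<lambda>(t, \<omega>). indicator {0..T} t * f (X t \<omega>)) \<in> borel_measurable (lborel \<Otimes>\<^sub>M M)"
proof -
  \<comment> \<open>The \<open>+ 1\<close> keeps \<open>a k t\<close> strictly above
    \<open>t\<close> even at grid points, as \<open>at_right\<close> demands; \<open>nat\<close>
    keeps the sampling times positive also for negative \<open>t\<close>, where the process is not
    known to be measurable.\<close>
  define a :: "nat \<Rightarrow> real \<Rightarrow> real" where "a k t = real (nat \<lfloor>t * Suc k\<rfloor> + 1) / Suc k" for k t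
  have meas: "(\<lambda>(t, \<omega>). indicator {0..T} t * f (X (a k t) \<omega>)) \<in> borel_measurable (lborel \<Otimes>\<^sub>M M)" for k
  proof -
    have "(\<lambda>z. f (X (real (nat \<lfloor>fst z * Suc k\<rfloor> + 1) / Suc k) (snd z))) \<in> borel_measurable (lborel \<Otimes>\<^sub>M M)"
    \<comment> \<open>On each grid cell the sampling time is constant, so only the measurability of
      \<open>X\<close> at countably many fixed times is involved.\<close>
    proof (rule measurable_compose_countable[where g = "\<lambda>z. nat \<lfloor>fst z * real (Suc k)\<rfloor>" and
          f = "\<lambda>j z. f (X (real (j + 1) / Suc k) (snd z))"])
      show "(\<lambda>z. f (X (real (j + 1) / Suc k) (snd z))) \<in> borel_measurable (lborel \<Otimes>\<^sub>M M)" for j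
        by (rule measurable_compose[OF measurable_snd measurable_function_of_state]) simp
    qed measurable
    then show ?thesis
      unfolding a_def by (simp add: case_prod_beta)
  qed
  show ?thesis
  proof (rule borel_measurable_LIMSEQ_real[OF _ meas])
    fix z :: "real \<times> 'w" assume "z \<in> space (lborel \<Otimes>\<^sub>M M)"
    then obtain t \<omega> where z: "z = (t, \<omega>)" and \<omega>: "\<omega> \<in> space M"
      by (auto simp: space_pair_measure)
    show "(\<lambda>k. case z of (t, \<omega>) \<Rightarrow> indicator {0..T} t * f (X (a k t) \<omega>))
        \<longlonglongrightarrow> (case z of (t, \<omega>) \<Rightarrow> indicator {0..T} t * f (X t \<omega>))"
    proof (cases "t \<in> {0..T}")
      case True
      then have t: "t \<ge> 0" by simp
      have a_bounds: "t < a k t \<and> a k t \<le> t + 1 / Suc k" for k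
      proof -
        have "real (nat \<lfloor>t * Suc k\<rfloor>) = of_int \<lfloor>t * Suc k\<rfloor>"
          using t by simp
        then have "t * Suc k < real (nat \<lfloor>t * Suc k\<rfloor> + 1)" "real (nat \<lfloor>t * Suc k\<rfloor> + 1) \<le> t * Suc k + 1"
          by linarith+
        then show ?thesis
          unfolding a_def by (simp add: field_simps del: of_nat_Suc)
      qed
      have "(\<lambda>k. a k t) \<longlonglongrightarrow> t"
      proof (rule real_tendsto_sandwich[where f = "\<lambda>_. t" and h = "\<lambda>k. t + 1 / Suc k"])
        show "(\<lambda>k. t + 1 / real (Suc k)) \<longlonglongrightarrow> t"
          using tendsto_add[OF tendsto_const LIMSEQ_inverse_real_of_nat] by (simp add: inverse_eq_divide)
      qed (use a_bounds in \<open>auto intro!: always_eventually less_imp_le\<close>)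
      then have "filterlim (\<lambda>k. a k t) (at_right t) sequentially"
        using a_bounds by (auto simp: filterlim_at less_imp_neq[THEN not_sym])
      then have "\<forall>\<^sub>F k in sequentially. X (a k t) \<omega> = X t \<omega>"
        using right_continuous_paths[OF \<omega> t] by (rule eventually_compose_filterlim[rotated])
      then show ?thesis
        unfolding z by (auto intro!: tendsto_eventually elim: eventually_mono)
    qed (simp add: z)
  qed
qed

text \<open>Fubini's theorem applies because the integrand is dominated by the constant
  \<open>K\<close> on a rectangle of finite measure.\<close>

lemma expectation_time_integral:
  fixes f :: "'s \<Rightarrow> real"
  shows "expectation (\<lambda>\<omega>. LINT t:{0..T}|lborel. f (X t \<omega>)) =
      (LINT t:{0..T}|lborel. expectation (\<lambda>\<omega>. f (X t \<omega>)))"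
proof -
  interpret pair: pair_sigma_finite "lborel :: real measure" M ..
  let ?F = "\<lambda>(t::real) \<omega>. indicator {0..T} t * f (X t \<omega>)"
  define K where "K = (\<Sum>x\<in>E. \<bar>f x\<bar>)"
  have "integrable (lborel \<Otimes>\<^sub>M M) (\<lambda>z. indicator ({0..T} \<times> space M) z *\<^sub>R K)"
    by (intro integrable_scaleR_left integrable_real_indicator)
       (auto simp: emeasure_pair_measure_Times ennreal_mult_less_top emeasure_eq_measure emeasure_lborel_Icc_eq)
  then have "integrable (lborel \<Otimes>\<^sub>M M) (case_prod ?F)"
  proof (rule Bochner_Integration.integrable_bound[OF _ jointly_measurable_function_of_state])
    show "AE z in lborel \<Otimes>\<^sub>M M. norm (case_prod ?F z) \<le> norm (indicator ({0..T} \<times> space M) z *\<^sub>R K)"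
    proof (rule AE_I2)
      fix z :: "real \<times> 'w" assume "z \<in> space (lborel \<Otimes>\<^sub>M M)"
      then obtain t \<omega> where z: "z = (t, \<omega>)" and \<omega>: "\<omega> \<in> space M"
        by (auto simp: space_pair_measure)
      have "\<bar>f (X t \<omega>)\<bar> \<le> \<bar>K\<bar>" if "t \<ge> 0"
        unfolding K_def
        using member_le_sum[OF state_in_states[OF that \<omega>], of "\<lambda>x. \<bar>f x\<bar>"] finite_states
        by (simp add: sum_nonneg)
      then show "norm (case_prod ?F z) \<le> norm (indicator ({0..T} \<times> space M) z *\<^sub>R K)"
        using \<omega> by (auto simp: z indicator_def)
    qed
  qed
  from pair.Fubini_integral[OF this] show ?thesis
    by (simp add: set_lebesgue_integral_def)
qed

end

section \<open>The Poisson equation of the network\<close>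

text \<open>Up to the factor \<open>\<lambda>\<^sub>e\<close> this is the expected time for which node \<open>i\<close> is fresh before the next
  source update, starting from \<open>A\<close>: with \<open>m\<close> stale nodes, \<open>m\<close> times its value \<open>w m\<close> at a stale node
  solves \<open>(\<lambda>\<^sub>s + \<lambda>\<^sub>e) (m * w m) = \<lambda>\<^sub>s + \<lambda>\<^sub>s ((m - 1) * w (m - 1))\<close>.\<close>

definition dc_rc_potential :: "nat \<Rightarrow> real \<Rightarrow> real \<Rightarrow> nat \<Rightarrow> nat set \<Rightarrow> real" where
  "dc_rc_potential n lam_s lam_e i A =
     (if i \<in> A then 1
      else lam_s / (lam_e * real (n - card A)) * (1 - (lam_s / (lam_s + lam_e)) ^ (n - card A)))"

text \<open>Summing over the target \<open>B\<close> first leaves one term per transition, because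
  \<open>{}\<close> and every \<open>insert j A\<close> belong to the state space. When
  \<open>A = {}\<close> the source update contributes zero.\<close>

lemma sum_dc_rc_rate:
  fixes f :: "nat set \<Rightarrow> real"
  assumes A: "A \<subseteq> {1..n}"
  shows "(\<Sum>B\<in>Pow {1..n}. dc_rc_rate n lam_s lam_e A B * (f B - f A)) =
    lam_e * (f {} - f A) + (\<Sum>j\<in>{1..n} - A. lam_s / real (n - card A) * (f (insert j A) - f A))"
proof -
  have "(\<Sum>B\<in>Pow {1..n}. dc_rc_rate n lam_s lam_e A B * (f B - f A)) =
     (\<Sum>B\<in>Pow {1..n}. if B = {} then lam_e * (f B - f A) else 0) +
     (\<Sum>B\<in>Pow {1..n}. \<Sum>j\<in>{1..n} - A. if B = insert j A then lam_s / real (n - card A) * (f B - f A) else 0)"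
    by (simp add: dc_rc_rate_def distrib_right sum.distrib sum_distrib_right if_distrib[of "\<lambda>x. x * _"]
        cong: if_cong)
  also have "(\<Sum>B\<in>Pow {1..n}. if B = {} then lam_e * (f B - f A) else 0) = lam_e * (f {} - f A)"
    by simp
  also have "(\<Sum>B\<in>Pow {1..n}. \<Sum>j\<in>{1..n} - A. if B = insert j A then lam_s / real (n - card A) * (f B - f A) else 0)
      = (\<Sum>j\<in>{1..n} - A. lam_s / real (n - card A) * (f (insert j A) - f A))"
    using A by (subst sum.swap) (auto intro!: sum.cong)
  finally show ?thesis .
qed

text \<open>If \<open>i\<close> is fresh, node updates leave the potential at 1 and only the source
  update counts. If \<open>i\<close> is stale, an update makes either \<open>i\<close> fresh or one
  of the \<open>m\<close> other stale nodes, and the recursion for the potential applies.\<close>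

lemma dc_rc_potential_poisson_equation:
  assumes pos: "lam_s > 0" "lam_e > 0" and A: "A \<subseteq> {1..n}" and i: "i \<in> {1..n}"
  defines "\<phi> \<equiv> dc_rc_potential n lam_s lam_e i"
  shows "(\<Sum>B\<in>Pow {1..n}. dc_rc_rate n lam_s lam_e A B * (\<phi> B - \<phi> A)) =
    lam_e * (\<phi> {} - indicator A i)"
proof (cases "i \<in> A")
  case True
  then have "\<phi> A = 1" "\<phi> (insert j A) = 1" for j
    by (simp_all add: \<phi>_def dc_rc_potential_def)
  with True show ?thesis
    unfolding sum_dc_rc_rate[OF A] by simp
next
  case False
  define r where "r = lam_s / (lam_s + lam_e)"
  have fin: "finite A"
    using A finite_subset by blast
  have card_compl: "card ({1..n} - A) = n - card A"
    using A by (simp add: card_Diff_subset fin)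
  moreover have "{1..n} - A \<noteq> {}"
    using i False by blast
  ultimately obtain m where m: "n - card A = Suc m"
    by (metis card_eq_0_iff finite_Diff finite_atLeastAtMost not0_implies_Suc)
  have card_rest: "card ({1..n} - A - {i}) = m"
    using i False card_compl m by simp
  define \<psi> where "\<psi> = lam_s / (lam_e * real m) * (1 - r ^ m)"
  have \<phi>A: "\<phi> A = lam_s / (lam_e * real (Suc m)) * (1 - r ^ Suc m)"
    using False m by (simp add: \<phi>_def dc_rc_potential_def r_def)
  have \<phi>_insert: "\<phi> (insert j A) = \<psi>" if "j \<in> {1..n} - A - {i}" for j
  proof -
    have "n - card (insert j A) = m"
      using that m fin by simp
    then show ?thesis
      using that False by (simp add: \<phi>_def dc_rc_potential_def \<psi>_def r_def)
  qed
  have \<phi>_insert_i: "\<phi> (insert i A) = 1"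
    by (simp add: \<phi>_def dc_rc_potential_def)
  have "(\<Sum>j\<in>{1..n} - A. \<phi> (insert j A) - \<phi> A) = (1 - \<phi> A) + (\<Sum>j\<in>{1..n} - A - {i}. \<phi> (insert j A) - \<phi> A)"
    using i False by (subst sum.remove[of _ i]) (simp_all add: \<phi>_insert_i)
  also have "\<dots> = (1 - \<phi> A) + real m * (\<psi> - \<phi> A)"
    using card_rest \<phi>_insert by simp
  also have "\<dots> = 1 + real m * \<psi> - real (Suc m) * \<phi> A"
    by (simp add: algebra_simps)
  \<comment> \<open>When \<open>i\<close> is the only stale node, \<open>m = 0\<close>: division by
    zero makes \<open>\<psi>\<close> zero, and the right-hand side vanishes because
    \<open>r ^ 0 = 1\<close>.\<close>
  also have "real m * \<psi> = lam_s / lam_e * (1 - r ^ m)"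
    by (cases "m = 0") (simp_all add: \<psi>_def)
  also have "real (Suc m) * \<phi> A = lam_s / lam_e * (1 - r ^ Suc m)"
    by (simp add: \<phi>A del: of_nat_Suc power_Suc)
  finally have drift: "(\<Sum>j\<in>{1..n} - A. \<phi> (insert j A) - \<phi> A) =
      1 + lam_s / lam_e * (1 - r ^ m) - lam_s / lam_e * (1 - r ^ Suc m)" .
  have "1 + lam_s / lam_e * (1 - r ^ m) - lam_s / lam_e * (1 - r ^ Suc m) =
      1 - r ^ m * (lam_s / lam_e * (1 - r))"
    by (simp add: algebra_simps diff_divide_distrib)
  \<comment> \<open>This identity, from \<open>1 - r = lam_e / (lam_s + lam_e)\<close>, is what
    fixes the base of the geometric term.\<close>
  also have "lam_s / lam_e * (1 - r) = r"
    using pos by (simp add: r_def field_simps)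
  finally have drift: "(\<Sum>j\<in>{1..n} - A. \<phi> (insert j A) - \<phi> A) = 1 - r ^ Suc m"
    using drift by simp
  \<comment> \<open>The gain from node updates thus cancels the loss
    \<open>lam_e * \<phi> A\<close>, leaving \<open>lam_e * \<phi> {}\<close>, whose value need not
    be computed here.\<close>
  have "lam_e * \<phi> A = lam_s / real (Suc m) * (1 - r ^ Suc m)"
    using pos by (simp add: \<phi>A)
  with drift show ?thesis
    unfolding sum_dc_rc_rate[OF A] m sum_distrib_left[symmetric]
    using False by (simp add: right_diff_distrib)
qed

section \<open>The long-term average freshness\<close>

theorem lemma2:
  fixes n i :: nat and lam_s lam_e :: real
    and M :: "'w measure" and S :: "real \<Rightarrow> 'w \<Rightarrow> nat set"
  assumes "n \<ge> 1" and "lam_s > 0" and "lam_e > 0"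
    and "dc_rc_network n lam_s lam_e M S"
    and "i \<in> {1..n}"
  shows "long_term_average M (freshness S i) =
           ereal (lam_s / (real n * lam_e) * (1 - (lam_s / (lam_s + lam_e)) ^ n))"
proof -
  interpret finite_ctmc M "Pow {1..n}" "dc_rc_rate n lam_s lam_e" S
    using assms(4) by (simp add: dc_rc_network_def)
  define \<phi> where "\<phi> = dc_rc_potential n lam_s lam_e i"
  define G where "G t = expectation (\<lambda>\<omega>. \<phi> (S t \<omega>))" for t
  define K where "K = (\<Sum>A\<in>Pow {1..n}. \<bar>\<phi> A\<bar>)"
  define c where "c = lam_s / (real n * lam_e) * (1 - (lam_s / (lam_s + lam_e)) ^ n)"
  let ?H = "\<lambda>t. expectation (freshness S i t)"
  \<comment> \<open>With no fresh node, \<open>n - card {}\<close> is \<open>n\<close>: the claimed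
    average is the potential right after a source update.\<close>
  have \<phi>_empty: "\<phi> {} = c"
    by (simp add: \<phi>_def dc_rc_potential_def c_def mult.commute)
  have drift: "expectation (\<lambda>\<omega>. generator \<phi> (S t \<omega>)) = lam_e * (c - ?H t)" if "t \<ge> 0" for t
  proof -
    have "expectation (\<lambda>\<omega>. generator \<phi> (S t \<omega>)) = expectation (\<lambda>\<omega>. lam_e * (c - freshness S i t \<omega>))"
    proof (rule Bochner_Integration.integral_cong[OF refl])
      fix \<omega> assume "\<omega> \<in> space M"
      then have "S t \<omega> \<subseteq> {1..n}"
        using state_in_states[OF that] by blast
      then show "generator \<phi> (S t \<omega>) = lam_e * (c - freshness S i t \<omega>)"
        unfolding generator_def freshness_def
        using dc_rc_potential_poisson_equation[OF assms(2,3) _ assms(5)] \<phi>_empty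
        by (simp add: \<phi>_def)
    qed
    moreover have "integrable M (freshness S i t)"
      unfolding freshness_def
      using measurable_function_of_state[OF that, of "\<lambda>A. indicator A i"]
      by (intro integrable_const_bound[where B = 1]) auto
    ultimately show ?thesis
      by (simp add: prob_space)
  qed
  \<comment> \<open>An exact identity at every finite horizon: the deviation from \<open>c\<close>
    is a pure boundary term.\<close>
  have average: "1 / T * expectation (\<lambda>\<omega>. LINT t:{0..T}|lborel. freshness S i t \<omega>) =
      c - (G T - G 0) / (lam_e * T)" if T: "T > 0" for T
  proof -
    have "continuous_on {0..T} ?H"
      unfolding freshness_def
      by (rule continuous_on_subset[OF continuous_on_expectation_function_of_state]) auto
    then have int: "set_integrable lborel {0..T} ?H"
      by (rule borel_integrable_atLeastAtMost')
    have "G T - G 0 = (LINT t:{0..T}|lborel. lam_e * (c - ?H t))"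
      unfolding G_def dynkin_formula[OF less_imp_le[OF T], symmetric]
      using drift by (intro set_lebesgue_integral_cong) auto
    also have "\<dots> = lam_e * (c * T - (LINT t:{0..T}|lborel. ?H t))"
      using T set_integral_diff(2)[OF borel_integrable_atLeastAtMost'[OF continuous_on_const, of 0 T c] int]
      by (simp add: set_lebesgue_integral_def mult.commute)
    finally have "(LINT t:{0..T}|lborel. ?H t) = c * T - (G T - G 0) / lam_e"
      using assms(3) by (simp add: field_simps)
    moreover have "expectation (\<lambda>\<omega>. LINT t:{0..T}|lborel. freshness S i t \<omega>) = (LINT t:{0..T}|lborel. ?H t)"
      unfolding freshness_def by (rule expectation_time_integral)
    ultimately show ?thesis
      using T assms(3) by (simp add: field_simps)
  qed
  have "((\<lambda>T. (G T - G 0) / (lam_e * T)) \<longlongrightarrow> 0) at_top"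
  proof (rule Lim_null_comparison)
    show "((\<lambda>T. (2 * K / lam_e) / T) \<longlongrightarrow> 0) at_top"
      by (rule tendsto_divide_0[OF tendsto_const filterlim_at_top_imp_at_infinity[OF filterlim_ident]])
    show "\<forall>\<^sub>F T in at_top. norm ((G T - G 0) / (lam_e * T)) \<le> (2 * K / lam_e) / T"
      using eventually_gt_at_top[of 0]
    proof eventually_elim
      case (elim T)
      have "\<bar>G T\<bar> \<le> K" "\<bar>G 0\<bar> \<le> K"
        unfolding G_def K_def using elim by (intro abs_expectation_function_of_state_le; simp)+
      then have "\<bar>G T - G 0\<bar> \<le> 2 * K"
        by linarith
      then show ?case
        using elim assms(3) by (simp add: abs_mult divide_right_mono)
    qed
  qed
  then have "((\<lambda>T. c - (G T - G 0) / (lam_e * T)) \<longlongrightarrow> c - 0) at_top"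
    by (intro tendsto_intros)
  moreover have "\<forall>\<^sub>F T in at_top. c - (G T - G 0) / (lam_e * T) =
      1 / T * expectation (\<lambda>\<omega>. LINT t:{0..T}|lborel. freshness S i t \<omega>)"
    using eventually_gt_at_top[of 0] by eventually_elim (rule average[symmetric])
  ultimately have "((\<lambda>T. 1 / T * expectation (\<lambda>\<omega>. LINT t:{0..T}|lborel. freshness S i t \<omega>)) \<longlongrightarrow> c) at_top"
    by (simp add: Lim_transform_eventually)
  \<comment> \<open>The averages converge, so their limit superior is the limit.\<close>
  then show ?thesis
    unfolding long_term_average_def c_def[symmetric]
    by (intro lim_imp_Limsup) (simp_all only: tendsto_ereal trivial_limit_at_top_linorder not_False_eq_True)
qed

end
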